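(* Let $\mathbf{A}\in\mathbb{R}^{N\times N}$ be the coefficient matrix of the linear ODE system $\frac{d\mathbf{u}}{dt}=\mathbf{A}\mathbf{u}+\mathbf{b}$ obtained by the finite volume spatial discretisation, described in the context, of the $m$-layer diffusion problem with Type GI or Type GII conditions at each interface. Then the backward Euler and Crank-Nicolson schemes for this system are both unconditionally stable: for every time step $\tau>0$ the matrices $\mathbf{I}-\tau\mathbf{A}$ and $\mathbf{I}-\frac{\tau}{2}\mathbf{A}$ are invertible, and the iteration matrices $$\mathbf{A}_B=(\mathbf{I}-\tau\mathbf{A})^{-1},\qquad \mathbf{A}_C=\left(\mathbf{I}-\tfrac{\tau}{2}\mathbf{A}\right)^{-1}\left(\mathbf{I}+\tfrac{\tau}{2}\mathbf{A}\right)$$ satisfy $\rho(\mathbf{A}_B)\le1$ and $\rho(\mathbf{A}_C)\le1$, where $\rho$ denotes the spectral radius.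
   Context: **Multilayer diffusion problem.** Let $m$ be a positive integer and $l_0<l_1<\dots<l_m$ real numbers. For $i=1,\dots,m$ let $D_i>0$ (diffusivity) and $\gamma_i>0$ (conductivity) be constants. The problem is $$\frac{\partial u_i}{\partial t}=D_i\frac{\partial^2u_i}{\partial x^2},\quad l_{i-1}<x<l_i,\ t>0,\qquad u_i(x,0)=f_i(x),\qquad i=1,\dots,m,$$ $$a_Lu_1(l_0,t)-b_L\frac{\partial u_1}{\partial x}(l_0,t)=c_L,\qquad a_Ru_m(l_m,t)+b_R\frac{\partial u_m}{\partial x}(l_m,t)=c_R,$$ where $a_L,b_L,c_L,a_R,b_R,c_R\ge 0$ are constants with $a_L+b_L>0$, $a_R+b_R>0$, and the case $a_L=a_R=0$ (Neumann conditions on both boundaries) is excluded. At each interface $x=l_i$ ($i=1,\dots,m-1$) one of the following pairs of conditions is imposed (the type may differ from interface to interface), with constants $\theta_i>0$, $H_i>0$: - Type GI: $u_i(l_i,t)=\theta_iu_{i+1}(l_i,t)$ and $\gamma_i\frac{\partial u_i}{\partial x}(l_i,t)=\gamma_{i+1}\frac{\partial u_{i+1}}{\partial x}(l_i,t)$. - Type GII: $\gamma_i\frac{\partial u_i}{\partial x}(l_i,t)=H_i(\theta_iu_{i+1}(l_i,t)-u_i(l_i,t))$ and $\gamma_i\frac{\partial u_i}{\partial x}(l_i,t)=\gamma_{i+1}\frac{\partial u_{i+1}}{\partial x}(l_i,t)$. **Mesh.** Let $n\ge 2$ be an integer, $h_i=(l_i-l_{i-1})/n$, and $x_{i,j}=l_{i-1}+jh_i$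 for $i=1,\dots,m$, $j=0,\dots,n$. The discrete unknown $u_{i,j}(t)$ approximates $u_i(x_{i,j},t)$. **Unknowns.** The vector $\mathbf{u}$ lists $u_{1,0},u_{1,1},\dots,u_{1,n},u_{2,0},\dots,u_{m,n}$ in this order, but with the following entries removed and, wherever they occur in the equations below, replaced as indicated: - if $b_L=0$, $u_{1,0}$ is removed and replaced by $c_L/a_L$; - if $b_R=0$, $u_{m,n}$ is removed and replaced by $c_R/a_R$; - at each Type GI interface $x=l_i$ with $\theta_i\ge1$, $u_{i+1,0}$ is removed and replaced by $u_{i,n}/\theta_i$; - at each Type GI interface $x=l_i$ with $\theta_i<1$, $u_{i,n}$ is removed and replaced by $\theta_iu_{i+1,0}$. $N$ is the number of remaining unknowns. **Finite volume equations** (one for each remaining unknown). - Interior nodes, $1\le i\le m$, $1\le j\le n-1$: $\frac{du_{i,j}}{dt}=\frac{D_i}{h_i^2}(u_{i,j+1}-2u_{i,j}+u_{i,j-1})$. - Left boundary, if $b_L\ne0$: $\frac{du_{1,0}}{dt}=-\frac{2D_1}{h_1}\left[\frac1{h_1}+\frac{a_L}{b_L}\right]u_{1,0}+\frac{2D_1}{h_1^2}u_{1,1}+\frac{2D_1c_L}{h_1b_L}$. - Right boundary, if $b_R\ne0$: $\frac{du_{m,n}}{dt}=\frac{2D_m}{h_m^2}u_{m,n-1}-\frac{2D_m}{h_m}\left[\frac1{h_m}+\frac{a_R}{b_R}\right]u_{m,n}+\frac{2D_mc_R}{h_mb_R}$. - Type GI interface with $\theta_i\ge1$: $\frac{du_{i,n}}{dt}=\frac{2D_iD_{i+1}\theta_i}{\gamma_ih_i\theta_iD_{i+1}+\gamma_{i+1}h_{i+1}D_i}\left[\frac{\gamma_i}{h_i}u_{i,n-1}-\left(\frac{\gamma_i}{h_i}+\frac{\gamma_{i+1}}{\theta_ih_{i+1}}\right)u_{i,n}+\frac{\gamma_{i+1}}{h_{i+1}}u_{i+1,1}\right]$.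 - Type GI interface with $\theta_i<1$: $\frac{du_{i+1,0}}{dt}=\frac{2D_iD_{i+1}}{\gamma_ih_i\theta_iD_{i+1}+\gamma_{i+1}h_{i+1}D_i}\left[\frac{\gamma_i}{h_i}u_{i,n-1}-\left(\frac{\theta_i\gamma_i}{h_i}+\frac{\gamma_{i+1}}{h_{i+1}}\right)u_{i+1,0}+\frac{\gamma_{i+1}}{h_{i+1}}u_{i+1,1}\right]$. - Type GII interface: $\frac{du_{i,n}}{dt}=\frac{2D_i}{\gamma_ih_i}\left[\frac{\gamma_i}{h_i}u_{i,n-1}-\left(H_i+\frac{\gamma_i}{h_i}\right)u_{i,n}+\theta_iH_iu_{i+1,0}\right]$ and $\frac{du_{i+1,0}}{dt}=\frac{2D_{i+1}}{\gamma_{i+1}h_{i+1}}\left[H_iu_{i,n}-\left(\theta_iH_i+\frac{\gamma_{i+1}}{h_{i+1}}\right)u_{i+1,0}+\frac{\gamma_{i+1}}{h_{i+1}}u_{i+1,1}\right]$. Collecting these equations gives $\frac{d\mathbf{u}}{dt}=\mathbf{A}\mathbf{u}+\mathbf{b}$, with $\mathbf{A}\in\mathbb{R}^{N\times N}$ the (tridiagonal) matrix of coefficients of the unknowns and $\mathbf{b}\in\mathbb{R}^N$ the vector of constant terms. **Time stepping and stability.** With $\mathbf{I}$ the $N\times N$ identity matrix and time step $\tau>0$, the backward Euler scheme is $\mathbf{u}^{(k+1)}=\mathbf{A}_B(\mathbf{u}^{(k)}+\tau\mathbf{b})$ and the Crank-Nicolson scheme is $\mathbf{u}^{(k+1)}=\mathbf{A}_C\mathbf{u}^{(k)}+\tau(\mathbf{I}-\frac{\tau}{2}\mathbf{A})^{-1}\mathbf{b}$.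 A scheme is called stable (for a given $\tau$) if the spectral radius of its iteration matrix is at most $1$, and unconditionally stable if this holds for every $\tau>0$. *)

theory Defs
  imports "Jordan_Normal_Form.Spectral_Radius" "Jordan_Normal_Form.Gauss_Jordan_Elimination"
begin

section \<open>Multilayer diffusion problems\<close>

datatype interface =
    GI (theta: real)
  | GII (theta: real) (contact_transfer: real)

text \<open>
  Layers are numbered \<open>1..m\<close>; layer \<open>i\<close> is the interval from \<open>pos (i - 1)\<close> to \<open>pos i\<close>,
  and the interface at \<open>pos i\<close>, for \<open>1 \<le> i < m\<close>, separates layers \<open>i\<close> and \<open>i + 1\<close>.
  Values of the fields at other indices are irrelevant. The initial data are not part of the
  record because they do not enter the semi-discrete system.
\<close>

record diffusion_problem =
  layers :: nat
  pos :: "nat \<Rightarrow> real"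
  diffus :: "nat \<Rightarrow> real"
  conduct :: "nat \<Rightarrow> real"
  aL :: real
  bL :: real
  cL :: real
  aR :: real
  bR :: real
  cR :: real
  iface :: "nat \<Rightarrow> interface"

definition valid_problem :: "diffusion_problem \<Rightarrow> bool" where
  "valid_problem P \<longleftrightarrow>
     layers P \<ge> 1 \<and>
     (\<forall>i < layers P. pos P i < pos P (i + 1)) \<and>
     (\<forall>i \<in> {1..layers P}. diffus P i > 0 \<and> conduct P i > 0) \<and>
     (\<forall>i \<in> {1..<layers P}.
        case iface P i of GI \<theta> \<Rightarrow> \<theta> > 0 | GII \<theta> H \<Rightarrow> \<theta> > 0 \<and> H > 0) \<and>
     aL P \<ge> 0 \<and> bL P \<ge> 0 \<and> cL P \<ge> 0 \<and> aR P \<ge> 0 \<and> bR P \<ge> 0 \<and> cR P \<ge> 0 \<and>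
     aL P + bL P > 0 \<and> aR P + bR P > 0 \<and> \<not> (aL P = 0 \<and> aR P = 0)"


section \<open>Finite volume semi-discretisation\<close>

definition mesh_width :: "diffusion_problem \<Rightarrow> nat \<Rightarrow> nat \<Rightarrow> real" where
  "mesh_width P n i = (pos P i - pos P (i - 1)) / real n"

text \<open>
  The pair \<open>(i, j)\<close> stands for the mesh node \<open>pos (i - 1) + j * h\<^sub>i\<close> of layer \<open>i\<close>.
  A node is eliminated if its value is prescribed by a boundary condition or is a multiple of the
  value on the other side of a GI interface.
\<close>

definition eliminated :: "diffusion_problem \<Rightarrow> nat \<Rightarrow> nat \<times> nat \<Rightarrow> bool" where
  "eliminated P n = (\<lambda>(i, j).
     (i = 1 \<and> j = 0 \<and> bL P = 0) \<or>
     (i = layers P \<and> j = n \<and> bR P = 0) \<or>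
     (1 < i \<and> j = 0 \<and> (\<exists>\<theta>. iface P (i - 1) = GI \<theta> \<and> \<theta> \<ge> 1)) \<or>
     (i < layers P \<and> j = n \<and> (\<exists>\<theta>. iface P i = GI \<theta> \<and> \<theta> < 1)))"

text \<open>\<open>List.product\<close> enumerates lexicographically: \<open>(1,0), \<dots>, (1,n), (2,0), \<dots>, (m,n)\<close>.\<close>

definition unknowns :: "diffusion_problem \<Rightarrow> nat \<Rightarrow> (nat \<times> nat) list" where
  "unknowns P n =
     filter (\<lambda>p. \<not> eliminated P n p) (List.product [1..<layers P + 1] [0..<n + 1])"

definition num_unknowns :: "diffusion_problem \<Rightarrow> nat \<Rightarrow> nat" where
  "num_unknowns P n = length (unknowns P n)"

text \<open>The value at \<open>(i, j)\<close>, with the eliminated nodes replaced by their substitutes.\<close>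

definition node_value ::
  "diffusion_problem \<Rightarrow> nat \<Rightarrow> (nat \<times> nat \<Rightarrow> real) \<Rightarrow> nat \<Rightarrow> nat \<Rightarrow> real" where
  "node_value P n w i j =
     (if \<not> eliminated P n (i, j) then w (i, j)
      else if i = 1 \<and> j = 0 then cL P / aL P
      else if i = layers P \<and> j = n then cR P / aR P
      else if j = 0 then w (i - 1, n) / theta (iface P (i - 1))
      else theta (iface P i) * w (i + 1, 0))"

text \<open>
  The right-hand side of the equation for \<open>du\<^sub>i\<^sub>,\<^sub>j/dt\<close>; only its values at nodes that are not
  eliminated matter.
\<close>

definition fv_rhs ::
  "diffusion_problem \<Rightarrow> nat \<Rightarrow> (nat \<times> nat \<Rightarrow> real) \<Rightarrow> nat \<times> nat \<Rightarrow> real" where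
  "fv_rhs P n w = (\<lambda>(i, j).
     let m = layers P; D = diffus P; \<gamma> = conduct P; h = mesh_width P n; u = node_value P n w in
     if 1 \<le> j \<and> j \<le> n - 1 then
       D i / (h i)^2 * (u i (j + 1) - 2 * u i j + u i (j - 1))
     else if i = 1 \<and> j = 0 then
       - (2 * D 1 / h 1) * (1 / h 1 + aL P / bL P) * u 1 0
       + 2 * D 1 / (h 1)^2 * u 1 1 + 2 * D 1 * cL P / (h 1 * bL P)
     else if i = m \<and> j = n then
       2 * D m / (h m)^2 * u m (n - 1)
       - 2 * D m / h m * (1 / h m + aR P / bR P) * u m n + 2 * D m * cR P / (h m * bR P)
     else if j = n then
       (case iface P i of
          GI \<theta> \<Rightarrow>
            2 * D i * D (i+1) * \<theta> / (\<gamma> i * h i * \<theta> * D (i+1) + \<gamma> (i+1) * h (i+1) * D i)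
            * (\<gamma> i / h i * u i (n - 1)
               - (\<gamma> i / h i + \<gamma> (i+1) / (\<theta> * h (i+1))) * u i n
               + \<gamma> (i+1) / h (i+1) * u (i+1) 1)
        | GII \<theta> H \<Rightarrow>
            2 * D i / (\<gamma> i * h i)
            * (\<gamma> i / h i * u i (n - 1) - (H + \<gamma> i / h i) * u i n + \<theta> * H * u (i+1) 0))
     else
       (let k = i - 1 in
        case iface P k of
          GI \<theta> \<Rightarrow>
            2 * D k * D (k+1) / (\<gamma> k * h k * \<theta> * D (k+1) + \<gamma> (k+1) * h (k+1) * D k)
            * (\<gamma> k / h k * u k (n - 1)
               - (\<theta> * \<gamma> k / h k + \<gamma> (k+1) / h (k+1)) * u (k+1) 0
               + \<gamma> (k+1) / h (k+1) * u (k+1) 1)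
        | GII \<theta> H \<Rightarrow>
            2 * D (k+1) / (\<gamma> (k+1) * h (k+1))
            * (H * u k n - (\<theta> * H + \<gamma> (k+1) / h (k+1)) * u (k+1) 0
               + \<gamma> (k+1) / h (k+1) * u (k+1) 1)))"

text \<open>
  The right-hand sides are affine in the unknowns, so the coefficient of the unknown \<open>q\<close> is the
  increment of the right-hand side when \<open>q\<close> changes from 0 to 1 and the other unknowns are 0
  (see \<open>fv_rhs_eq_system\<close> below).
\<close>

definition system_matrix :: "diffusion_problem \<Rightarrow> nat \<Rightarrow> real mat" where
  "system_matrix P n =
     mat (num_unknowns P n) (num_unknowns P n) (\<lambda>(r, s).
       fv_rhs P n (\<lambda>q. if q = unknowns P n ! s then 1 else 0) (unknowns P n ! r)
       - fv_rhs P n (\<lambda>q. 0) (unknowns P n ! r))"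

definition system_vector :: "diffusion_problem \<Rightarrow> nat \<Rightarrow> real vec" where
  "system_vector P n = vec (num_unknowns P n) (\<lambda>r. fv_rhs P n (\<lambda>q. 0) (unknowns P n ! r))"

lemma system_matrix_carrier:
  "system_matrix P n \<in> carrier_mat (num_unknowns P n) (num_unknowns P n)"
  by (simp add: system_matrix_def)

lemma distinct_unknowns: "distinct (unknowns P n)"
  unfolding unknowns_def by (intro distinct_filter distinct_product) auto

lemma node_value_lin:
  "node_value P n (\<lambda>q. w q + c * v q) i j =
   node_value P n w i j + c * (node_value P n v i j - node_value P n (\<lambda>q. 0) i j)"
  by (simp add: node_value_def add_divide_distrib distrib_left)

lemma fv_rhs_lin:
  "fv_rhs P n (\<lambda>q. w q + c * v q) p =
   fv_rhs P n w p + c * (fv_rhs P n v p - fv_rhs P n (\<lambda>q. 0) p)"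
proof -
  obtain i j where p: "p = (i, j)" by (cases p)
  have lin1: "A * (X + c * (X' - X0) - 2 * (Y + c * (Y' - Y0)) + (Z + c * (Z' - Z0))) =
      A * (X - 2 * Y + Z) + c * (A * (X' - 2 * Y' + Z') - A * (X0 - 2 * Y0 + Z0))"
    for A X X' X0 Y Y' Y0 Z Z' Z0 :: real
    by (simp add: algebra_simps)
  have lin2: "- A * B * (X + c * (X' - X0)) + E * (Y + c * (Y' - Y0)) + F =
      - A * B * X + E * Y + F + c * ((- A * B * X' + E * Y' + F) - (- A * B * X0 + E * Y0 + F))"
    for A B E F X X' X0 Y Y' Y0 :: real
    by (simp add: algebra_simps)
  have lin3: "E * (X + c * (X' - X0)) - A * B * (Y + c * (Y' - Y0)) + F =
      E * X - A * B * Y + F + c * ((E * X' - A * B * Y' + F) - (E * X0 - A * B * Y0 + F))"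
    for A B E F X X' X0 Y Y' Y0 :: real
    by (simp add: algebra_simps)
  have lin4: "A * (B * (X + c * (X' - X0)) - E * (Y + c * (Y' - Y0)) + F * (Z + c * (Z' - Z0))) =
      A * (B * X - E * Y + F * Z)
      + c * (A * (B * X' - E * Y' + F * Z') - A * (B * X0 - E * Y0 + F * Z0))"
    for A B E F X X' X0 Y Y' Y0 Z Z' Z0 :: real
    by (simp add: algebra_simps)
  consider "1 \<le> j \<and> j \<le> n - 1" | "\<not> (1 \<le> j \<and> j \<le> n - 1)" "i = 1 \<and> j = 0"
    | "\<not> (1 \<le> j \<and> j \<le> n - 1)" "\<not> (i = 1 \<and> j = 0)" "i = layers P \<and> j = n"
    | "\<not> (1 \<le> j \<and> j \<le> n - 1)" "\<not> (i = 1 \<and> j = 0)" "\<not> (i = layers P \<and> j = n)" "j = n"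
    | "\<not> (1 \<le> j \<and> j \<le> n - 1)" "\<not> (i = 1 \<and> j = 0)" "\<not> (i = layers P \<and> j = n)" "j \<noteq> n"
    by blast
  then show ?thesis
  proof cases
    case 1
    then show ?thesis
      unfolding fv_rhs_def p prod.case Let_def node_value_lin by (simp only: if_P if_not_P lin1)
  next
    case 2
    then show ?thesis
      unfolding fv_rhs_def p prod.case Let_def node_value_lin
      by (simp only: if_P if_not_P simp_thms lin2)
  next
    case 3
    show ?thesis
      unfolding fv_rhs_def p prod.case Let_def node_value_lin
      by (simp only: if_not_P[OF 3(1)] if_not_P[OF 3(2)] if_P[OF 3(3)] lin3)
  next
    case 4
    show ?thesis
      unfolding fv_rhs_def p prod.case Let_def node_value_lin
        if_not_P[OF 4(1)] if_not_P[OF 4(2)] if_not_P[OF 4(3)] if_P[OF 4(4)]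
      by (cases "iface P i") (simp_all only: interface.case lin4)
  next
    case 5
    show ?thesis
      unfolding fv_rhs_def p prod.case Let_def node_value_lin
        if_not_P[OF 5(1)] if_not_P[OF 5(2)] if_not_P[OF 5(3)] if_not_P[OF 5(4)]
      by (cases "iface P (i - 1)") (simp_all only: interface.case lin4)
  qed
qed

lemma in_unknowns:
  "(i, j) \<in> set (unknowns P n) \<longleftrightarrow>
     1 \<le> i \<and> i \<le> layers P \<and> j \<le> n \<and> \<not> eliminated P n (i, j)"
  by (auto simp: unknowns_def)

lemma num_unknowns_pos:
  assumes "valid_problem P" "n \<ge> 2"
  shows "num_unknowns P n > 0"
proof -
  have "(1, 1) \<in> set (unknowns P n)"
    using assms by (simp add: in_unknowns eliminated_def valid_problem_def)
  then show ?thesis by (auto simp: num_unknowns_def)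
qed

lemma node_value_cong:
  assumes n: "n \<ge> 2" and eq: "\<And>q. q \<in> set (unknowns P n) \<Longrightarrow> w q = w' q"
    and ij: "1 \<le> i" "i \<le> layers P" "j \<le> n"
  shows "node_value P n w i j = node_value P n w' i j"
proof (cases "eliminated P n (i, j)")
  case False
  then show ?thesis using ij eq[of "(i, j)"] by (simp add: node_value_def in_unknowns)
next
  case True
  have "w (i - 1, n) = w' (i - 1, n)"
    if "1 < i" "iface P (i - 1) = GI \<theta>" "\<theta> \<ge> 1" for \<theta>
  proof -
    have "(i - 1, n) \<in> set (unknowns P n)"
      using that ij n by (auto simp: in_unknowns eliminated_def)
    then show ?thesis by (rule eq)
  qed
  moreover have "w (i + 1, 0) = w' (i + 1, 0)"
    if "i < layers P" "iface P i = GI \<theta>" "\<theta> < 1" for \<theta>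
  proof -
    have "(i + 1, 0) \<in> set (unknowns P n)"
      using that ij n by (auto simp: in_unknowns eliminated_def)
    then show ?thesis by (rule eq)
  qed
  ultimately show ?thesis using True n
    by (auto simp: node_value_def eliminated_def)
qed

lemma fv_rhs_cong:
  assumes n: "n \<ge> 2" and eq: "\<And>q. q \<in> set (unknowns P n) \<Longrightarrow> w q = w' q"
    and p: "p \<in> set (unknowns P n)"
  shows "fv_rhs P n w p = fv_rhs P n w' p"
proof -
  obtain i j where ij: "p = (i, j)" by (cases p)
  have b: "1 \<le> i" "i \<le> layers P" "j \<le> n" using p by (auto simp: ij in_unknowns)
  have nv: "node_value P n w k l = node_value P n w' k l"
    if "1 \<le> k" "k \<le> layers P" "l \<le> n" for k l
    using node_value_cong[OF n eq that] .
  show ?thesis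
    unfolding ij fv_rhs_def prod.case Let_def
    using b n by (auto simp: nv split: interface.split)
qed

lemma fv_rhs_expand:
  assumes "finite S"
  shows "fv_rhs P n (\<lambda>q. if q \<in> S then w q else 0) p =
    fv_rhs P n (\<lambda>q. 0) p
    + (\<Sum>s\<in>S. w s * (fv_rhs P n (\<lambda>q. if q = s then 1 else 0) p - fv_rhs P n (\<lambda>q. 0) p))"
  using assms
proof (induction S)
  case empty
  then show ?case by simp
next
  case (insert s S)
  have "(\<lambda>q. if q \<in> insert s S then w q else 0) =
      (\<lambda>q. (if q \<in> S then w q else 0) + w s * (if q = s then 1 else 0))"
    using insert.hyps by auto
  then show ?case
    using insert fv_rhs_lin[of P n "\<lambda>q. if q \<in> S then w q else 0" "w s" "\<lambda>q. if q = s then 1 else 0" p]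
    by simp
qed

lemma fv_rhs_eq_system:
  assumes "n \<ge> 2"
  shows "vec (num_unknowns P n) (\<lambda>r. fv_rhs P n w (unknowns P n ! r)) =
    system_matrix P n *\<^sub>v vec (num_unknowns P n) (\<lambda>r. w (unknowns P n ! r)) + system_vector P n"
proof (rule eq_vecI)
  fix r
  assume "r < dim_vec (system_matrix P n *\<^sub>v vec (num_unknowns P n) (\<lambda>r. w (unknowns P n ! r))
    + system_vector P n)"
  then have r: "r < num_unknowns P n" by (simp add: system_vector_def)
  let ?U = "unknowns P n" and ?p = "unknowns P n ! r"
  let ?c = "\<lambda>s. fv_rhs P n (\<lambda>q. if q = s then 1 else 0) ?p - fv_rhs P n (\<lambda>q. 0) ?p"
  have mem: "?p \<in> set ?U" using r by (simp add: num_unknowns_def)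
  have bij: "bij_betw (\<lambda>s. ?U ! s) {0..<num_unknowns P n} (set ?U)"
    by (rule bij_betw_nth[OF distinct_unknowns]) (auto simp: num_unknowns_def)
  have "fv_rhs P n w ?p = fv_rhs P n (\<lambda>q. if q \<in> set ?U then w q else 0) ?p"
    by (rule fv_rhs_cong[OF assms _ mem]) simp
  also have "\<dots> = fv_rhs P n (\<lambda>q. 0) ?p + (\<Sum>s\<in>set ?U. w s * ?c s)"
    by (rule fv_rhs_expand) simp
  also have "(\<Sum>s\<in>set ?U. w s * ?c s) = (\<Sum>s = 0..<num_unknowns P n. w (?U ! s) * ?c (?U ! s))"
    using sum.reindex_bij_betw[OF bij, of "\<lambda>s. w s * ?c s"] by simp
  finally show "vec (num_unknowns P n) (\<lambda>r. fv_rhs P n w (?U ! r)) $ r =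
      (system_matrix P n *\<^sub>v vec (num_unknowns P n) (\<lambda>r. w (?U ! r)) + system_vector P n) $ r"
    using r by (simp add: system_matrix_def system_vector_def scalar_prod_def mult.commute)
qed (simp add: system_vector_def)


section \<open>Time stepping\<close>

definition mat_inv :: "real mat \<Rightarrow> real mat" where
  "mat_inv M = the (mat_inverse M)"

lemma mat_inv:
  assumes "M \<in> carrier_mat k k" "invertible_mat M"
  shows "mat_inv M \<in> carrier_mat k k" "M * mat_inv M = 1\<^sub>m k" "mat_inv M * M = 1\<^sub>m k"
proof -
  obtain B where B: "M * B = 1\<^sub>m k" "B * M = 1\<^sub>m (dim_row B)"
    using assms by (auto simp: invertible_mat_def inverts_mat_def)
  have "dim_col B = k" using arg_cong[OF B(1), of dim_col] by simp
  moreover have "dim_row B = k" using arg_cong[OF B(2), of dim_col] assms(1) by simp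
  ultimately have "M \<in> Units (ring_mat TYPE(real) k ())"
    using B assms(1) unfolding Units_def by (auto simp: ring_mat_def intro!: bexI[of _ B])
  then obtain C where C: "mat_inverse M = Some C"
    using mat_inverse(1)[OF assms(1), of "()"] by (cases "mat_inverse M") auto
  then show "mat_inv M \<in> carrier_mat k k" "M * mat_inv M = 1\<^sub>m k" "mat_inv M * M = 1\<^sub>m k"
    using mat_inverse(2)[OF assms(1) C] by (simp_all add: mat_inv_def)
qed

definition backward_euler_matrix :: "real mat \<Rightarrow> real \<Rightarrow> real mat" where
  "backward_euler_matrix A \<tau> = mat_inv (1\<^sub>m (dim_row A) - \<tau> \<cdot>\<^sub>m A)"

definition crank_nicolson_matrix :: "real mat \<Rightarrow> real \<Rightarrow> real mat" where
  "crank_nicolson_matrix A \<tau> =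
     mat_inv (1\<^sub>m (dim_row A) - (\<tau> / 2) \<cdot>\<^sub>m A) * (1\<^sub>m (dim_row A) + (\<tau> / 2) \<cdot>\<^sub>m A)"

text \<open>
  Stability of a one-step scheme, as a property of its iteration matrix \<open>M\<close>. The spectral radius is
  taken over the complex eigenvalues; its definition as a maximum is meaningful because there is
  always at least one unknown (\<open>num_unknowns_pos\<close>).
\<close>

definition stable :: "real mat \<Rightarrow> bool" where
  "stable M \<longleftrightarrow> spectral_radius (map_mat complex_of_real M) \<le> 1"

definition unconditionally_stable :: "(real \<Rightarrow> real mat) \<Rightarrow> bool" where
  "unconditionally_stable M \<longleftrightarrow> (\<forall>\<tau>>0. stable (M \<tau>))"

end

theory Submission
  imports Defs
begin

text \<open>
  Both schemes are stable because every eigenvalue \<open>z\<close> of the system matrix \<open>A\<close> has \<open>Re z \<le> 0\<close>: the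
  iteration matrices are rational functions of \<open>A\<close> whose values \<open>1 / (1 - \<tau> z)\<close> and
  \<open>(1 + \<tau> z / 2) / (1 - \<tau> z / 2)\<close> have modulus at most 1 on the closed left half plane
  (\<open>stable_one_step_scheme\<close>, which treats both schemes at once as
  \<open>(I - c A)\<inverse> (I + d A)\<close> with \<open>0 \<le> d \<le> c\<close>).

  The plain Gershgorin theorem does not give \<open>Re z \<le> 0\<close>: at an interface with \<open>\<theta> \<noteq> 1\<close> a row sum of \<open>A\<close>
  can be positive. The remedy is a diagonal scaling. The interface conditions with zero flux are
  satisfied by a function that is constant, equal to \<open>W i > 0\<close>, in each layer \<open>i\<close>, provided that
  \<open>W i = \<theta>\<^sub>i * W (i + 1)\<close>. Let \<open>w\<close> be its vector of nodal values. It is a steady state of the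
  homogeneous equations except at the two ends, where the boundary conditions only make \<open>A w\<close>
  smaller; hence \<open>A w \<le> 0\<close> (\<open>fv_rhs_layer_constant_le\<close>). The off-diagonal entries of \<open>A\<close> are
  nonnegative (\<open>fv_rhs_quasi_positive\<close>), so in the variables \<open>u / w\<close> each Gershgorin disc has its
  centre \<open>a \<le> 0\<close> on the real axis and radius at most \<open>-a\<close>, and lies in the left half plane
  (\<open>Re_eigenvalue_nonpos\<close>).

  Both sign properties are checked on the equations themselves and not on the matrix entries. The
  matrix acts as the right-hand side for \<open>c\<^sub>L = c\<^sub>R = 0\<close> (\<open>system_matrix_row_sum\<close>), and substituting
  for the eliminated nodes preserves nonnegativity and the upper bound \<open>W i\<close>.
\<close>


section \<open>Matrices with nonnegative off-diagonal entries and a positive supersolution\<close>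

text \<open>
  Gershgorin's argument for the matrix scaled by \<open>diag w\<close>, read off at an index where
  \<open>cmod (v $ s) / w s\<close> is largest for an eigenvector \<open>v\<close>.
\<close>
lemma Re_eigenvalue_nonpos:
  fixes A :: "real mat" and w :: "nat \<Rightarrow> real"
  assumes A: "A \<in> carrier_mat N N"
    and offdiag: "\<And>r s. r < N \<Longrightarrow> s < N \<Longrightarrow> r \<noteq> s \<Longrightarrow> A $$ (r, s) \<ge> 0"
    and w_pos: "\<And>s. s < N \<Longrightarrow> w s > 0"
    and super: "\<And>r. r < N \<Longrightarrow> (\<Sum>s<N. A $$ (r, s) * w s) \<le> 0"
    and ev: "eigenvalue (map_mat complex_of_real A) z"
  shows "Re z \<le> 0"
proof -
  obtain v where v: "v \<in> carrier_vec N" "v \<noteq> 0\<^sub>v N"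
    and Av: "map_mat complex_of_real A *\<^sub>v v = z \<cdot>\<^sub>v v"
    using ev A by (auto simp: eigenvalue_def eigenvector_def)
  obtain k where k: "k < N" "v $ k \<noteq> 0"
    using v by (metis carrier_vecD eq_vecI index_zero_vec(1,2))
  define f where "f s = cmod (v $ s) / w s" for s
  obtain r where r: "r < N" and r_max: "\<And>s. s < N \<Longrightarrow> f s \<le> f r"
  proof -
    have "finite (f ` {..<N})" "f ` {..<N} \<noteq> {}" using k by auto
    then have "Max (f ` {..<N}) \<in> f ` {..<N}" by (rule Max_in)
    then obtain r where "r < N" "f r = Max (f ` {..<N})" by auto
    then show ?thesis using that[of r] by simp
  qed
  have fr: "f r > 0"
  proof -
    have "f k > 0" using k w_pos by (simp add: f_def)
    then show ?thesis using r_max[OF k(1)] by simp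
  qed
  have v_le: "cmod (v $ s) \<le> f r * w s" if "s < N" for s
    proof -
    have "cmod (v $ s) = f s * w s" using w_pos[OF that] by (simp add: f_def)
    then show ?thesis using mult_right_mono[OF r_max[OF that], of "w s"] w_pos[OF that] by simp
  qed
  have v_r: "cmod (v $ r) = f r * w r" using w_pos[OF r] by (simp add: f_def)
  have split: "{..<N} = insert r ({..<N} - {r})" using r by auto
  have "z * v $ r = (map_mat complex_of_real A *\<^sub>v v) $ r" using v r by (simp add: Av)
  also have "\<dots> = (\<Sum>s<N. of_real (A $$ (r, s)) * v $ s)"
    using A v r by (auto simp: scalar_prod_def lessThan_atLeast0 intro!: sum.cong)
  also have "\<dots> = of_real (A $$ (r, r)) * v $ r
      + (\<Sum>s\<in>{..<N} - {r}. of_real (A $$ (r, s)) * v $ s)"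
    by (subst split, subst sum.insert) auto
  finally have "(z - of_real (A $$ (r, r))) * v $ r
      = (\<Sum>s\<in>{..<N} - {r}. of_real (A $$ (r, s)) * v $ s)"
    by (simp add: algebra_simps)
  then have "cmod (z - of_real (A $$ (r, r))) * (f r * w r)
      = cmod (\<Sum>s\<in>{..<N} - {r}. of_real (A $$ (r, s)) * v $ s)"
    by (metis norm_mult v_r)
  also have "\<dots> \<le> (\<Sum>s\<in>{..<N} - {r}. A $$ (r, s) * (f r * w s))"
  proof (rule sum_norm_le)
    fix s assume s: "s \<in> {..<N} - {r}"
    then have "A $$ (r, s) \<ge> 0" using offdiag r by auto
    then show "cmod (of_real (A $$ (r, s)) * v $ s) \<le> A $$ (r, s) * (f r * w s)"
      using s v_le[of s] by (simp add: norm_mult mult_left_mono)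
  qed
  also have "\<dots> = f r * (\<Sum>s\<in>{..<N} - {r}. A $$ (r, s) * w s)"
    by (simp add: sum_distrib_left mult_ac)
  also have "\<dots> \<le> f r * (- A $$ (r, r) * w r)"
  proof (rule mult_left_mono)
    have "(\<Sum>s<N. A $$ (r, s) * w s) = A $$ (r, r) * w r + (\<Sum>s\<in>{..<N} - {r}. A $$ (r, s) * w s)"
      by (subst split, subst sum.insert) auto
    then show "(\<Sum>s\<in>{..<N} - {r}. A $$ (r, s) * w s) \<le> - A $$ (r, r) * w r"
      using super[OF r] by simp
  qed (use fr in simp)
  finally have "cmod (z - of_real (A $$ (r, r))) * (f r * w r) \<le> - A $$ (r, r) * (f r * w r)"
    by (simp add: mult_ac)
  then have "cmod (z - of_real (A $$ (r, r))) \<le> - A $$ (r, r)"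
    by (rule mult_right_le_imp_le) (use fr w_pos[OF r] in simp)
  then show ?thesis
    using complex_Re_le_cmod[of "z - of_real (A $$ (r, r))"] by simp
qed


section \<open>One-step schemes for dissipative matrices\<close>

text \<open>A kernel vector of \<open>I - c A\<close> would be an eigenvector of \<open>A\<close> for the positive eigenvalue \<open>1 / c\<close>.\<close>
lemma invertible_mat_one_minus_smult:
  fixes A :: "real mat"
  assumes A: "A \<in> carrier_mat N N"
    and Re_le: "\<And>z. eigenvalue (map_mat complex_of_real A) z \<Longrightarrow> Re z \<le> 0"
    and c: "c > 0"
  shows "invertible_mat (1\<^sub>m N - c \<cdot>\<^sub>m A)"
proof -
  let ?M = "1\<^sub>m N - c \<cdot>\<^sub>m A"
  have M: "?M \<in> carrier_mat N N" using A by (intro minus_carrier_mat smult_carrier_mat)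
  have "det ?M \<noteq> 0"
  proof
    assume "det ?M = 0"
    then obtain v where v: "v \<in> carrier_vec N" "v \<noteq> 0\<^sub>v N" "?M *\<^sub>v v = 0\<^sub>v N"
      using det_0_iff_vec_prod_zero[OF M] by auto
    have "v - c \<cdot>\<^sub>v (A *\<^sub>v v) = ?M *\<^sub>v v"
      using A v(1) by (subst minus_mult_distrib_mat_vec[of _ N N]) auto
    then have eq: "v - c \<cdot>\<^sub>v (A *\<^sub>v v) = 0\<^sub>v N" using v(3) by simp
    have "A *\<^sub>v v = (1 / c) \<cdot>\<^sub>v v"
    proof (rule eq_vecI)
      fix i assume "i < dim_vec ((1 / c) \<cdot>\<^sub>v v)"
      then have i: "i < N" using v(1) by simp
      have "(v - c \<cdot>\<^sub>v (A *\<^sub>v v)) $ i = 0" using eq i by simp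
      then have "v $ i = c * (A *\<^sub>v v) $ i" using A v(1) i by simp
      then show "(A *\<^sub>v v) $ i = ((1 / c) \<cdot>\<^sub>v v) $ i" using c v(1) i by simp
    qed (use A v(1) in simp)
    then have "eigenvalue A (1 / c)"
      using A v by (auto simp: eigenvalue_def eigenvector_def)
    from Re_le[OF of_real_hom.eigenvalue_hom[OF A this]] show False using c by simp
  qed
  from det_non_zero_imp_unit[OF M this, of "()"] obtain B
    where "B \<in> carrier_mat N N" "B * ?M = 1\<^sub>m N" "?M * B = 1\<^sub>m N"
    unfolding Units_def ring_mat_def by auto
  then show ?thesis
    using A unfolding invertible_mat_def inverts_mat_def by (auto intro!: exI[of _ B])
qed

text \<open>
  The equation says \<open>\<mu> = (1 + d z) / (1 - c z)\<close>; the denominator does not vanish because its real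
  part is at least 1. On the left half plane \<open>1 + d z\<close> is no larger in modulus than \<open>1 - c z\<close>: the
  difference of the squared moduli is \<open>2 (c + d) Re z - (c\<^sup>2 - d\<^sup>2) \<bar>z\<bar>\<^sup>2\<close>.
\<close>
lemma norm_le_1_of_stability_function:
  fixes \<mu> z :: complex and c d :: real
  assumes eq: "1 + of_real d * z = \<mu> * (1 - of_real c * z)"
    and "Re z \<le> 0" "0 \<le> d" "d \<le> c" "c > 0"
  shows "cmod \<mu> \<le> 1"
proof -
  let ?p = "1 + of_real d * z" and ?q = "1 - of_real c * z"
  have "Re ?q \<ge> 1" using assms by (simp add: mult_nonneg_nonpos)
  then have "?q \<noteq> 0" by (metis not_one_le_zero zero_complex.simps(1))
  have "(cmod ?p)\<^sup>2 \<le> (cmod ?q)\<^sup>2"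
  proof -
    have "d\<^sup>2 \<le> c\<^sup>2" using assms by (intro power_mono) auto
    then have "d\<^sup>2 * ((Re z)\<^sup>2 + (Im z)\<^sup>2) \<le> c\<^sup>2 * ((Re z)\<^sup>2 + (Im z)\<^sup>2)"
      by (intro mult_right_mono) auto
    moreover have "(c + d) * Re z \<le> 0" using assms by (intro mult_nonneg_nonpos) auto
    ultimately show ?thesis
      unfolding cmod_power2 by (simp add: power2_eq_square algebra_simps)
  qed
  then have "cmod ?p \<le> cmod ?q" by (rule power2_le_imp_le) simp
  then have "cmod \<mu> * cmod ?q \<le> 1 * cmod ?q" by (simp add: eq norm_mult)
  then show ?thesis using \<open>?q \<noteq> 0\<close> by (simp add: mult_le_cancel_right)
qed

text \<open>
  Backward Euler is the case \<open>d = 0\<close>, Crank-Nicolson the case \<open>d = c\<close>. An eigenvector of the iteration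
  matrix is also an eigenvector of \<open>A\<close>, and the two eigenvalues are related by the stability function.
\<close>
lemma stable_one_step_scheme:
  fixes A :: "real mat"
  assumes A: "A \<in> carrier_mat N N" and N: "N > 0"
    and Re_le: "\<And>z. eigenvalue (map_mat complex_of_real A) z \<Longrightarrow> Re z \<le> 0"
    and c: "c > 0" and d: "0 \<le> d" "d \<le> c"
  shows "stable (mat_inv (1\<^sub>m N - c \<cdot>\<^sub>m A) * (1\<^sub>m N + d \<cdot>\<^sub>m A))"
proof -
  let ?C = "map_mat complex_of_real"
  let ?P = "1\<^sub>m N - c \<cdot>\<^sub>m A" and ?Q = "1\<^sub>m N + d \<cdot>\<^sub>m A"
  have P: "?P \<in> carrier_mat N N" and Q: "?Q \<in> carrier_mat N N"
    using A by (auto intro!: minus_carrier_mat)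
  note I = mat_inv[OF P invertible_mat_one_minus_smult[OF A Re_le c]]
  define M where "M = mat_inv ?P * ?Q"
  have M: "M \<in> carrier_mat N N" using I(1) Q by (simp add: M_def)
  have "?P * M = (?P * mat_inv ?P) * ?Q"
    unfolding M_def using P Q I(1) by (simp add: assoc_mult_mat[of _ N N _ N _ N])
  then have PM: "?P * M = ?Q" using left_mult_one_mat[OF Q] by (simp only: I(2))
  have "cmod \<mu> \<le> 1" if ev: "eigenvalue (?C M) \<mu>" for \<mu>
  proof -
    obtain v where v: "v \<in> carrier_vec N" "v \<noteq> 0\<^sub>v N" and Mv: "?C M *\<^sub>v v = \<mu> \<cdot>\<^sub>v v"
      using ev M by (auto simp: eigenvalue_def eigenvector_def)
    define y where "y = ?C A *\<^sub>v v"
    have y: "y \<in> carrier_vec N" using A v by (simp add: y_def)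
    have CP: "?C ?P = 1\<^sub>m N - of_real c \<cdot>\<^sub>m ?C A"
      using A by (intro eq_matI) auto
    have CQ: "?C ?Q = 1\<^sub>m N + of_real d \<cdot>\<^sub>m ?C A"
      using A by (intro eq_matI) auto
    have Pv: "?C ?P *\<^sub>v v = v - of_real c \<cdot>\<^sub>v y"
      unfolding CP y_def using A v(1) by (subst minus_mult_distrib_mat_vec[of _ N N]) auto
    have Qv: "?C ?Q *\<^sub>v v = v + of_real d \<cdot>\<^sub>v y"
      unfolding CQ y_def using A v(1) by (subst add_mult_distrib_mat_vec[of _ N N]) auto
    have "?C ?Q = ?C ?P * ?C M"
      unfolding PM[symmetric] by (rule of_real_hom.mat_hom_mult[OF P M])
    then have "?C ?Q *\<^sub>v v = (?C ?P * ?C M) *\<^sub>v v" by simp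
    also have "\<dots> = ?C ?P *\<^sub>v (\<mu> \<cdot>\<^sub>v v)"
      using P M v(1) by (subst assoc_mult_mat_vec[of _ N N _ N]) (auto simp: Mv)
    also have "\<dots> = \<mu> \<cdot>\<^sub>v (?C ?P *\<^sub>v v)"
      using P v(1) by (intro mult_mat_vec[of _ N N]) auto
    finally have eq: "v + of_real d \<cdot>\<^sub>v y = \<mu> \<cdot>\<^sub>v (v - of_real c \<cdot>\<^sub>v y)"
      by (simp only: Pv Qv)
    have entry: "(of_real d + \<mu> * of_real c) * y $ i = (\<mu> - 1) * v $ i" if "i < N" for i
    proof -
      have "(v + of_real d \<cdot>\<^sub>v y) $ i = (\<mu> \<cdot>\<^sub>v (v - of_real c \<cdot>\<^sub>v y)) $ i" by (simp add: eq)
      then show ?thesis using that v(1) y by (simp add: algebra_simps)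
    qed
    \<comment> \<open>The factor of \<open>y\<close> vanishes for no eigenvalue: it would give \<open>\<mu> = 1\<close>, hence \<open>d + c = 0\<close>.\<close>
    show ?thesis
    proof (cases "of_real d + \<mu> * of_real c = 0")
      case True
      obtain k where k: "k < N" "v $ k \<noteq> 0"
        using v by (metis carrier_vecD eq_vecI index_zero_vec(1,2))
      then have "\<mu> = 1" using entry[OF k(1)] True by simp
      with True have "d + c = 0" by (simp flip: of_real_add)
      then show ?thesis using c d by simp
    next
      case False
      define z where "z = (\<mu> - 1) / (of_real d + \<mu> * of_real c)"
      have "y = z \<cdot>\<^sub>v v"
      proof (rule eq_vecI)
        fix i assume "i < dim_vec (z \<cdot>\<^sub>v v)"
        then have i: "i < N" using v by simp
        show "y $ i = (z \<cdot>\<^sub>v v) $ i"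
          using entry[OF i] False i v(1) by (simp add: z_def field_simps)
      qed (use y v in simp)
      then have "eigenvalue (?C A) z"
        using A v by (auto simp: eigenvalue_def eigenvector_def y_def)
      then have "Re z \<le> 0" by (rule Re_le)
      moreover have "1 + of_real d * z = \<mu> * (1 - of_real c * z)"
      proof -
        have "z * (of_real d + \<mu> * of_real c) = \<mu> - 1" using False by (simp add: z_def)
        then show ?thesis by (simp add: algebra_simps)
      qed
      ultimately show ?thesis using norm_le_1_of_stability_function c d by blast
    qed
  qed
  moreover have "spectral_radius (?C M) \<in> cmod ` spectrum (?C M)"
    using M N by (intro spectral_radius_mem_max) auto
  ultimately show ?thesis
    by (auto simp: stable_def M_def[symmetric] spectrum_def)
qed


section \<open>The homogeneous problem\<close>

definition homogeneous :: "diffusion_problem \<Rightarrow> diffusion_problem" where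
  "homogeneous P = P\<lparr>cL := 0, cR := 0\<rparr>"

lemma homogeneous_simps [simp]:
  "layers (homogeneous P) = layers P" "pos (homogeneous P) = pos P"
  "diffus (homogeneous P) = diffus P" "conduct (homogeneous P) = conduct P"
  "aL (homogeneous P) = aL P" "bL (homogeneous P) = bL P" "cL (homogeneous P) = 0"
  "aR (homogeneous P) = aR P" "bR (homogeneous P) = bR P" "cR (homogeneous P) = 0"
  "iface (homogeneous P) = iface P"
  "mesh_width (homogeneous P) = mesh_width P"
  "eliminated (homogeneous P) = eliminated P"
  by (simp_all add: homogeneous_def mesh_width_def eliminated_def fun_eq_iff)

lemma valid_homogeneous: "valid_problem P \<Longrightarrow> valid_problem (homogeneous P)"
  by (simp add: valid_problem_def)

lemma unknowns_homogeneous: "unknowns (homogeneous P) n = unknowns P n"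
  by (simp add: unknowns_def)

lemma node_value_homogeneous:
  "node_value P n w i j = node_value (homogeneous P) n w i j + node_value P n (\<lambda>q. 0) i j"
  by (simp add: node_value_def)

text \<open>
  This identifies the linear part of the affine right-hand side: dropping the boundary data removes
  exactly the constant terms.
\<close>
lemma fv_rhs_homogeneous:
  "fv_rhs P n w p = fv_rhs (homogeneous P) n w p + fv_rhs P n (\<lambda>q. 0) p"
proof -
  obtain i j where p: "p = (i, j)" by (cases p)
  note unfold = p fv_rhs_def prod.case Let_def node_value_homogeneous[of P n w]
  consider "1 \<le> j \<and> j \<le> n - 1" | "\<not> (1 \<le> j \<and> j \<le> n - 1)" "i = 1 \<and> j = 0"
    | "\<not> (1 \<le> j \<and> j \<le> n - 1)" "\<not> (i = 1 \<and> j = 0)" "i = layers P \<and> j = n"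
    | "\<not> (1 \<le> j \<and> j \<le> n - 1)" "\<not> (i = 1 \<and> j = 0)" "\<not> (i = layers P \<and> j = n)" "j = n"
    | "\<not> (1 \<le> j \<and> j \<le> n - 1)" "\<not> (i = 1 \<and> j = 0)" "\<not> (i = layers P \<and> j = n)" "j \<noteq> n"
    by blast
  then show ?thesis
  proof cases
    case 1
    have "A * (X + X' - 2 * (Y + Y') + (Z + Z')) = A * (X - 2 * Y + Z) + A * (X' - 2 * Y' + Z')"
      for A X X' Y Y' Z Z' :: real
      by (simp add: algebra_simps)
    then show ?thesis unfolding unfold homogeneous_simps if_P[OF 1] by blast
  next
    case 2
    have "- A * B * (X + X') + E * (Y + Y') + F
        = - A * B * X + E * Y + 2 * C * 0 / G + (- A * B * X' + E * Y' + F)"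
      for A B C E F G X X' Y Y' :: real
      by (simp add: algebra_simps)
    then show ?thesis unfolding unfold homogeneous_simps if_not_P[OF 2(1)] if_P[OF 2(2)] by blast
  next
    case 3
    have "E * (X + X') - A * B * (Y + Y') + F
        = E * X - A * B * Y + 2 * C * 0 / G + (E * X' - A * B * Y' + F)"
      for A B C E F G X X' Y Y' :: real
      by (simp add: algebra_simps)
    then show ?thesis
      unfolding unfold homogeneous_simps if_not_P[OF 3(1)] if_not_P[OF 3(2)] if_P[OF 3(3)] by blast
  next
    case 4
    have "A * (B * (X + X') - E * (Y + Y') + F * (Z + Z'))
        = A * (B * X - E * Y + F * Z) + A * (B * X' - E * Y' + F * Z')"
      for A B E F X X' Y Y' Z Z' :: real
      by (simp add: algebra_simps)
    then show ?thesis
      unfolding unfold homogeneous_simps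
        if_not_P[OF 4(1)] if_not_P[OF 4(2)] if_not_P[OF 4(3)] if_P[OF 4(4)]
      by (cases "iface P i") (simp_all only: interface.case)
  next
    case 5
    have "A * (B * (X + X') - E * (Y + Y') + F * (Z + Z'))
        = A * (B * X - E * Y + F * Z) + A * (B * X' - E * Y' + F * Z')"
      for A B E F X X' Y Y' Z Z' :: real
      by (simp add: algebra_simps)
    then show ?thesis
      unfolding unfold homogeneous_simps
        if_not_P[OF 5(1)] if_not_P[OF 5(2)] if_not_P[OF 5(3)] if_not_P[OF 5(4)]
      by (cases "iface P (i - 1)") (simp_all only: interface.case)
  qed
qed


lemma homogeneous_fv_rhs_zero: "fv_rhs (homogeneous P) n (\<lambda>q. 0) p = 0"
  using fv_rhs_homogeneous[of P n "\<lambda>q. 0" p] by simp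

lemma system_matrix_entry:
  assumes "r < num_unknowns P n" "s < num_unknowns P n"
  shows "system_matrix P n $$ (r, s) =
    fv_rhs (homogeneous P) n (\<lambda>q. if q = unknowns P n ! s then 1 else 0) (unknowns P n ! r)"
  using assms by (simp add: system_matrix_def fv_rhs_homogeneous[of P n "\<lambda>q. if q = _ then _ else _"])

lemma system_matrix_row_sum:
  assumes n: "n \<ge> 2" and r: "r < num_unknowns P n"
  shows "(\<Sum>s<num_unknowns P n. system_matrix P n $$ (r, s) * w (unknowns P n ! s)) =
    fv_rhs (homogeneous P) n w (unknowns P n ! r)"
proof -
  have "fv_rhs P n w (unknowns P n ! r) =
      (system_matrix P n *\<^sub>v vec (num_unknowns P n) (\<lambda>s. w (unknowns P n ! s)) + system_vector P n) $ r"
    using arg_cong[OF fv_rhs_eq_system[OF n, of P w], of "\<lambda>x. x $ r"] r by simp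
  also have "\<dots> = (\<Sum>s<num_unknowns P n. system_matrix P n $$ (r, s) * w (unknowns P n ! s))
      + fv_rhs P n (\<lambda>q. 0) (unknowns P n ! r)"
    using r system_matrix_carrier[of P n]
    by (auto simp: system_vector_def scalar_prod_def lessThan_atLeast0 intro!: sum.cong)
  finally show ?thesis
    using fv_rhs_homogeneous[of P n w "unknowns P n ! r"] by simp
qed


section \<open>Signs of the finite volume equations\<close>

lemma valid_problemD:
  assumes "valid_problem P"
  shows "\<And>i. 1 \<le> i \<Longrightarrow> i \<le> layers P \<Longrightarrow> diffus P i > 0"
    and "\<And>i. 1 \<le> i \<Longrightarrow> i \<le> layers P \<Longrightarrow> conduct P i > 0"
    and "\<And>i. 1 \<le> i \<Longrightarrow> i < layers P \<Longrightarrow> theta (iface P i) > 0"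
    and "\<And>i \<theta> H. 1 \<le> i \<Longrightarrow> i < layers P \<Longrightarrow> iface P i = GII \<theta> H \<Longrightarrow> H > 0"
    and "aL P \<ge> 0" "bL P \<ge> 0" "aR P \<ge> 0" "bR P \<ge> 0"
proof -
  show "theta (iface P i) > 0" if "1 \<le> i" "i < layers P" for i
    using assms that by (cases "iface P i") (auto simp: valid_problem_def dest!: bspec[of _ _ i])
  show "H > 0" if "1 \<le> i" "i < layers P" "iface P i = GII \<theta> H" for i \<theta> H
    using assms that by (auto simp: valid_problem_def dest!: bspec[of _ _ i])
qed (use assms in \<open>auto simp: valid_problem_def\<close>)

lemma mesh_width_pos:
  assumes "valid_problem P" "n \<ge> 2" "1 \<le> i" "i \<le> layers P"
  shows "mesh_width P n i > 0"
proof -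
  have "pos P (i - 1) < pos P (i - 1 + 1)"
    using assms unfolding valid_problem_def by (metis Suc_eq_plus1 Suc_le_lessD Suc_pred One_nat_def)
  then show ?thesis using assms by (simp add: mesh_width_def)
qed

text \<open>
  Nodes are eliminated in favour of nonnegative multiples of unknowns, or of zero at a homogeneous
  Dirichlet end.
\<close>
lemma node_value_nonneg:
  assumes P: "valid_problem P" and n: "n \<ge> 2" and hom: "cL P = 0" "cR P = 0"
    and v: "\<And>q. v q \<ge> 0" and i: "1 \<le> i" "i \<le> layers P"
  shows "node_value P n v i j \<ge> 0"
proof (cases "eliminated P n (i, j)")
  case False
  then show ?thesis by (simp add: node_value_def v)
next
  case True
  have "v (i - 1, n) / theta (iface P (i - 1)) \<ge> 0" if "1 < i"
    using valid_problemD(3)[OF P, of "i - 1"] that i v by (intro divide_nonneg_pos) auto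
  moreover have "theta (iface P i) * v (i + 1, 0) \<ge> 0" if "i < layers P"
    using valid_problemD(3)[OF P, of i] that i v by (intro mult_nonneg_nonneg) (auto intro: less_imp_le)
  ultimately show ?thesis
    using True n by (auto simp: node_value_def eliminated_def hom)
qed

text \<open>
  In every equation the neighbouring nodes occur with nonnegative coefficients and only the node of
  the equation itself with a negative one. Applied to the indicator of another unknown, this bounds an
  off-diagonal matrix entry; the substitution for eliminated nodes is already inside \<open>node_value\<close>.
\<close>
lemma fv_rhs_quasi_positive:
  assumes P: "valid_problem P" and n: "n \<ge> 2" and hom: "cL P = 0" "cR P = 0"
    and v: "\<And>q. v q \<ge> 0" and p: "p \<in> set (unknowns P n)" and vp: "v p = 0"
  shows "fv_rhs P n v p \<ge> 0"
proof -
  obtain i j where ij: "p = (i, j)" by (cases p)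
  have b: "1 \<le> i" "i \<le> layers P" "j \<le> n" and ne: "\<not> eliminated P n (i, j)"
    using p by (auto simp: ij in_unknowns)
  have u: "node_value P n v k l \<ge> 0" if "1 \<le> k" "k \<le> layers P" for k l
    using node_value_nonneg[OF P n hom v that] .
  have uij: "node_value P n v i j = 0" using ne vp by (simp add: node_value_def ij)
  note pos = valid_problemD[OF P] mesh_width_pos[OF P n]
  consider "1 \<le> j \<and> j \<le> n - 1" | "i = 1" "j = 0" | "i = layers P" "j = n"
    | "i < layers P" "j = n" | "1 < i" "j = 0"
    using b by fastforce
  then show ?thesis
  proof cases
    case 1
    then show ?thesis
      using b uij u[of i] pos(1)[of i] by (simp add: ij fv_rhs_def Let_def)
  next
    case 2
    then show ?thesis
      using b n uij u[of 1] pos(1)[of 1] by (simp add: ij fv_rhs_def Let_def hom)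
  next
    case 3
    then show ?thesis
      using b n uij u[of i] pos(1)[of i] by (auto simp: ij fv_rhs_def Let_def hom)
  next
    case 4
    let ?D = "diffus P" and ?g = "conduct P" and ?h = "mesh_width P n"
    have i1: "1 \<le> i + 1" "i + 1 \<le> layers P" using 4 by auto
    note pos' = pos(1)[OF b(1,2)] pos(1)[OF i1] pos(2)[OF b(1,2)] pos(2)[OF i1]
      pos(9)[OF b(1,2)] pos(9)[OF i1]
    show ?thesis
    proof (cases "iface P i")
      case (GI \<theta>)
      then have "\<theta> > 0" using pos(3)[OF b(1) 4(1)] by simp
      then show ?thesis
        using 4 n GI pos' uij u[OF b(1,2)] u[OF i1]
        by (simp add: ij fv_rhs_def Let_def add_nonneg_nonneg)
    next
      case (GII \<theta> H)
      then have "\<theta> > 0" "H > 0" using pos(3)[OF b(1) 4(1)] pos(4)[OF b(1) 4(1)] by auto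
      then show ?thesis
        using 4 n GII pos' uij u[OF b(1,2)] u[OF i1]
        by (simp add: ij fv_rhs_def Let_def add_nonneg_nonneg)
    qed
  next
    case 5
    define k where "k = i - 1"
    have k: "1 \<le> k" "k \<le> layers P" "k < layers P" "i = k + 1" using 5 b by (auto simp: k_def)
    have i1: "1 \<le> k + 1" "k + 1 \<le> layers P" using k by auto
    note pos' = pos(1)[OF k(1,2)] pos(1)[OF i1] pos(2)[OF k(1,2)] pos(2)[OF i1]
      pos(9)[OF k(1,2)] pos(9)[OF i1]
    show ?thesis
    proof (cases "iface P k")
      case (GI \<theta>)
      then have "\<theta> > 0" using pos(3)[OF k(1,3)] by simp
      then show ?thesis
        using 5 k n GI pos' uij u[OF k(1,2)] u[OF i1]
        by (simp add: ij fv_rhs_def Let_def add_nonneg_nonneg)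
    next
      case (GII \<theta> H)
      then have "\<theta> > 0" "H > 0" using pos(3)[OF k(1,3)] pos(4)[OF k(1,3)] by auto
      then show ?thesis
        using 5 k n GII pos' uij u[OF k(1,2)] u[OF i1]
        by (simp add: ij fv_rhs_def Let_def add_nonneg_nonneg)
    qed
  qed
qed

text \<open>The solution of \<open>W i = \<theta>\<^sub>i * W (i + 1)\<close> with \<open>W 1 = 1\<close>.\<close>
definition layer_constant :: "diffusion_problem \<Rightarrow> nat \<Rightarrow> real" where
  "layer_constant P i = (\<Prod>k = 1..<i. 1 / theta (iface P k))"

lemma layer_constant_pos:
  assumes "valid_problem P" "i \<le> layers P"
  shows "layer_constant P i > 0"
  unfolding layer_constant_def using assms valid_problemD(3)[OF assms(1)] by (intro prod_pos) auto

lemma layer_constant_interface: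
  assumes "valid_problem P" "1 \<le> k" "k < layers P"
  shows "layer_constant P k = theta (iface P k) * layer_constant P (k + 1)"
  using assms(2) valid_problemD(3)[OF assms] by (simp add: layer_constant_def)

text \<open>
  The substitutions at GI interfaces reproduce \<open>layer_constant\<close> exactly. The inequality is strict only
  at a Dirichlet end, where the substitute is 0.
\<close>
lemma node_value_layer_constant_le:
  assumes P: "valid_problem P" and n: "n \<ge> 2" and hom: "cL P = 0" "cR P = 0"
    and i: "1 \<le> i" "i \<le> layers P"
  shows "node_value P n (\<lambda>(i, j). layer_constant P i) i j \<le> layer_constant P i"
proof (cases "eliminated P n (i, j)")
  case False
  then show ?thesis by (simp add: node_value_def)
next
  case True
  have substituted: "node_value P n (\<lambda>(i, j). layer_constant P i) i j =
      (if i = 1 \<and> j = 0 \<or> i = layers P \<and> j = n then 0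
       else if j = 0 then layer_constant P (i - 1) / theta (iface P (i - 1))
       else theta (iface P i) * layer_constant P (i + 1))"
    using True n by (simp add: node_value_def hom)
  consider "i = 1 \<and> j = 0 \<or> i = layers P \<and> j = n"
    | "\<not> (i = 1 \<and> j = 0 \<or> i = layers P \<and> j = n)" "j = 0" "1 < i"
    | "\<not> (i = 1 \<and> j = 0 \<or> i = layers P \<and> j = n)" "j \<noteq> 0" "i < layers P"
    using True i by (fastforce simp: eliminated_def)
  then show ?thesis
  proof cases
    case 1
    then show ?thesis unfolding substituted if_P[OF 1] using layer_constant_pos[OF P i(2)] by simp
  next
    case 2
    then have k: "1 \<le> i - 1" "i - 1 < layers P" "i - 1 + 1 = i" using i by auto
    show ?thesis
      unfolding substituted if_not_P[OF 2(1)] if_P[OF 2(2)]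
      using layer_constant_interface[OF P k(1,2), unfolded k(3)] valid_problemD(3)[OF P k(1,2)]
      by (metis nonzero_mult_div_cancel_left less_irrefl order_refl)
  next
    case 3
    show ?thesis
      unfolding substituted if_not_P[OF 3(1)] if_not_P[OF 3(2)]
      using layer_constant_interface[OF P i(1) 3(3)] by (simp only: order_refl)
  qed
qed

text \<open>
  Replacing every nodal value by the layer constant makes the differences and the interface fluxes
  vanish. What remains is the loss term \<open>- aL / bL * W 1\<close> or \<open>- aR / bR * W m\<close> of a boundary equation,
  and the drop next to a Dirichlet end; both are nonpositive.
\<close>
lemma fv_rhs_layer_constant_le:
  assumes P: "valid_problem P" and n: "n \<ge> 2" and hom: "cL P = 0" "cR P = 0"
    and p: "p \<in> set (unknowns P n)"
  shows "fv_rhs P n (\<lambda>(i, j). layer_constant P i) p \<le> 0"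
proof -
  obtain i j where ij: "p = (i, j)" by (cases p)
  have b: "1 \<le> i" "i \<le> layers P" "j \<le> n" and ne: "\<not> eliminated P n (i, j)"
    using p by (auto simp: ij in_unknowns)
  define W where "W = layer_constant P"
  define u where "u = node_value P n (\<lambda>(i, j). layer_constant P i)"
  have u_le: "u k l \<le> W k" if "1 \<le> k" "k \<le> layers P" for k l
    using node_value_layer_constant_le[OF P n hom that] by (simp add: u_def W_def)
  have u_ij: "u i j = W i" using ne by (simp add: u_def W_def node_value_def)
  have W_pos: "W i > 0" using layer_constant_pos[OF P b(2)] by (simp add: W_def)
  note pos = valid_problemD[OF P] mesh_width_pos[OF P n]
  note W_interface = layer_constant_interface[OF P, folded W_def]
  have last: "\<not> n \<le> n - 1" using n by simp
  note rhs = ij fv_rhs_def Let_def u_def[symmetric] hom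
  consider "1 \<le> j \<and> j \<le> n - 1" | "i = 1" "j = 0" | "i = layers P" "j = n"
    | "i < layers P" "j = n" | "1 < i" "j = 0"
    using b by fastforce
  then show ?thesis
  proof cases
    case 1
    have "u i (j + 1) - 2 * u i j + u i (j - 1) \<le> 0"
      using u_le[OF b(1,2), of "j + 1"] u_le[OF b(1,2), of "j - 1"] u_ij by linarith
    then show ?thesis
      using 1 pos(1)[OF b(1,2)] by (simp add: rhs mult_nonneg_nonpos divide_nonpos_nonneg)
  next
    case 2
    let ?c = "2 * diffus P 1 / mesh_width P n 1"
    have one: "1 \<le> layers P" using b 2 by simp
    have h: "mesh_width P n 1 > 0" and D: "diffus P 1 > 0" using pos one by auto
    have "fv_rhs P n (\<lambda>(i, j). layer_constant P i) p
        = ?c * ((u 1 1 - W 1) / mesh_width P n 1 - aL P / bL P * W 1)"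
      using 2 u_ij
      by (simp add: rhs power2_eq_square algebra_simps diff_divide_distrib add_divide_distrib)
    also have "\<dots> \<le> 0"
    proof -
      have "(u 1 1 - W 1) / mesh_width P n 1 \<le> 0"
        using u_le[of 1 1] one h by (simp add: divide_nonpos_pos)
      moreover have "aL P / bL P * W 1 \<ge> 0"
        using pos(5,6) W_pos 2 by simp
      ultimately show ?thesis using h D by (intro mult_nonneg_nonpos) auto
    qed
    finally show ?thesis .
  next
    case 3
    let ?c = "2 * diffus P i / mesh_width P n i"
    have h: "mesh_width P n i > 0" and D: "diffus P i > 0" using pos b by auto
    have "fv_rhs P n (\<lambda>(i, j). layer_constant P i) p
        = ?c * ((u i (n - 1) - W i) / mesh_width P n i - aR P / bR P * W i)"
      using 3 n last u_ij
      by (simp add: rhs power2_eq_square algebra_simps diff_divide_distrib add_divide_distrib)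
    also have "\<dots> \<le> 0"
    proof -
      have "(u i (n - 1) - W i) / mesh_width P n i \<le> 0"
        using u_le[OF b(1,2), of "n - 1"] h by (simp add: divide_nonpos_pos)
      moreover have "aR P / bR P * W i \<ge> 0"
        using pos(7,8) W_pos by simp
      ultimately show ?thesis using h D by (intro mult_nonneg_nonpos) auto
    qed
    finally show ?thesis .
  next
    case 4
    have i1: "1 \<le> i + 1" "i + 1 \<le> layers P" using 4 by auto
    define g where "g = conduct P i / mesh_width P n i"
    define g' where "g' = conduct P (i + 1) / mesh_width P n (i + 1)"
    note pos' = pos(1)[OF b(1,2)] pos(1)[OF i1] pos(2)[OF b(1,2)] pos(2)[OF i1]
      pos(9)[OF b(1,2)] pos(9)[OF i1]
    have "g > 0" "g' > 0" using pos' by (simp_all add: g_def g'_def)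
    then have gu: "g * u i (n - 1) \<le> g * W i" "g' * u (i + 1) 1 \<le> g' * W (i + 1)"
      using u_le[OF b(1,2)] u_le[OF i1] by simp_all
    have Wi: "W i = theta (iface P i) * W (i + 1)" using W_interface[OF b(1) 4(1)] .
    show ?thesis
    proof (cases "iface P i")
      case (GI \<theta>)
      then have \<theta>: "\<theta> > 0" using pos(3)[OF b(1) 4(1)] by simp
      have "fv_rhs P n (\<lambda>(i, j). layer_constant P i) p
          = 2 * diffus P i * diffus P (i+1) * \<theta> / (conduct P i * mesh_width P n i * \<theta> * diffus P (i+1)
              + conduct P (i+1) * mesh_width P n (i+1) * diffus P i)
            * (g * u i (n - 1) - (g + g' / \<theta>) * W i + g' * u (i + 1) 1)"
        using 4 n last GI u_ij by (simp add: rhs g_def g'_def mult.commute)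
      also have "\<dots> \<le> 0"
      proof (rule mult_nonneg_nonpos)
        have "(g + g' / \<theta>) * W i = g * W i + g' * W (i + 1)"
          using Wi GI \<theta> by (simp add: field_simps)
        then show "g * u i (n - 1) - (g + g' / \<theta>) * W i + g' * u (i + 1) 1 \<le> 0"
          using gu by linarith
      qed (use pos' \<theta> in \<open>simp add: add_nonneg_nonneg\<close>)
      finally show ?thesis .
    next
      case (GII \<theta> H)
      have H: "H > 0" and \<theta>: "\<theta> > 0"
        using pos(3)[OF b(1) 4(1)] pos(4)[OF b(1) 4(1)] GII by auto
      have "fv_rhs P n (\<lambda>(i, j). layer_constant P i) p
          = 2 * diffus P i / (conduct P i * mesh_width P n i)
            * (g * u i (n - 1) - (H + g) * W i + \<theta> * H * u (i + 1) 0)"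
        using 4 n last GII u_ij by (simp add: rhs g_def)
      also have "\<dots> \<le> 0"
      proof (rule mult_nonneg_nonpos)
        have "\<theta> * H * u (i + 1) 0 \<le> \<theta> * H * W (i + 1)"
          using H \<theta> u_le[OF i1] by simp
        also have "\<dots> = H * W i" using Wi GII by simp
        finally show "g * u i (n - 1) - (H + g) * W i + \<theta> * H * u (i + 1) 0 \<le> 0"
          using gu(1) by (simp add: distrib_right)
      qed (use pos' in simp)
      finally show ?thesis .
    qed
  next
    case 5
    define k where "k = i - 1"
    have k: "1 \<le> k" "k \<le> layers P" "k < layers P" "i = k + 1" using 5 b by (auto simp: k_def)
    have k1: "1 \<le> k + 1" "k + 1 \<le> layers P" using k by auto
    define g where "g = conduct P k / mesh_width P n k"
    define g' where "g' = conduct P (k + 1) / mesh_width P n (k + 1)"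
    note pos' = pos(1)[OF k(1,2)] pos(1)[OF k1] pos(2)[OF k(1,2)] pos(2)[OF k1]
      pos(9)[OF k(1,2)] pos(9)[OF k1]
    have "g > 0" "g' > 0" using pos' by (simp_all add: g_def g'_def)
    then have gu: "g * u k (n - 1) \<le> g * W k" "g' * u (k + 1) 1 \<le> g' * W (k + 1)"
      using u_le[OF k(1,2)] u_le[OF k1] by simp_all
    have Wk: "W k = theta (iface P k) * W (k + 1)" using W_interface[OF k(1,3)] .
    show ?thesis
    proof (cases "iface P k")
      case (GI \<theta>)
      then have \<theta>: "\<theta> > 0" using pos(3)[OF k(1,3)] by simp
      have "fv_rhs P n (\<lambda>(i, j). layer_constant P i) p
          = 2 * diffus P k * diffus P (k+1) / (conduct P k * mesh_width P n k * \<theta> * diffus P (k+1)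
              + conduct P (k+1) * mesh_width P n (k+1) * diffus P k)
            * (g * u k (n - 1) - (\<theta> * g + g') * W (k + 1) + g' * u (k + 1) 1)"
        using 5 k n GI u_ij by (simp add: rhs g_def g'_def)
      also have "\<dots> \<le> 0"
      proof (rule mult_nonneg_nonpos)
        have "(\<theta> * g + g') * W (k + 1) = g * W k + g' * W (k + 1)"
          using Wk GI by (simp add: algebra_simps)
        then show "g * u k (n - 1) - (\<theta> * g + g') * W (k + 1) + g' * u (k + 1) 1 \<le> 0"
          using gu by linarith
      qed (use pos' \<theta> in \<open>simp add: add_nonneg_nonneg\<close>)
      finally show ?thesis .
    next
      case (GII \<theta> H)
      have H: "H > 0" using pos(4)[OF k(1,3)] GII by auto
      have "fv_rhs P n (\<lambda>(i, j). layer_constant P i) p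
          = 2 * diffus P (k+1) / (conduct P (k+1) * mesh_width P n (k+1))
            * (H * u k n - (\<theta> * H + g') * W (k + 1) + g' * u (k + 1) 1)"
        using 5 k n GII u_ij by (simp add: rhs g'_def)
      also have "\<dots> \<le> 0"
      proof (rule mult_nonneg_nonpos)
        have "H * u k n \<le> H * W k" using H u_le[OF k(1,2)] by simp
        also have "\<dots> = \<theta> * H * W (k + 1)" using Wk GII by simp
        finally show "H * u k n - (\<theta> * H + g') * W (k + 1) + g' * u (k + 1) 1 \<le> 0"
          using gu(2) by (simp add: distrib_right)
      qed (use pos' in simp)
      finally show ?thesis .
    qed
  qed
qed


section \<open>Unconditional stability\<close>

lemma Re_eigenvalue_system_matrix_nonpos:
  assumes P: "valid_problem P" and n: "n \<ge> 2"
    and ev: "eigenvalue (map_mat complex_of_real (system_matrix P n)) z"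
  shows "Re z \<le> 0"
proof (rule Re_eigenvalue_nonpos[OF system_matrix_carrier _ _ _ ev])
  let ?N = "num_unknowns P n" and ?U = "unknowns P n" and ?Q = "homogeneous P"
  let ?W = "\<lambda>(i, j). layer_constant ?Q i"
  have mem: "?U ! r \<in> set ?U" if "r < ?N" for r using that by (simp add: num_unknowns_def)
  note Q = valid_homogeneous[OF P]
  show "system_matrix P n $$ (r, s) \<ge> 0" if "r < ?N" "s < ?N" "r \<noteq> s" for r s
  proof -
    have "?U ! r \<noteq> ?U ! s"
      using that distinct_unknowns[of P n] by (simp add: num_unknowns_def nth_eq_iff_index_eq)
    then show ?thesis
      unfolding system_matrix_entry[OF that(1,2)]
      by (intro fv_rhs_quasi_positive[OF Q n]) (use mem[OF that(1)] in \<open>simp_all add: unknowns_homogeneous\<close>)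
  qed
  show "?W (?U ! s) > 0" if "s < ?N" for s
  proof -
    obtain i j where ij: "?U ! s = (i, j)" by (cases "?U ! s")
    then have "i \<le> layers P" using mem[OF that] by (simp add: in_unknowns)
    then show ?thesis using layer_constant_pos[OF Q] by (simp add: ij)
  qed
  show "(\<Sum>s<?N. system_matrix P n $$ (r, s) * ?W (?U ! s)) \<le> 0" if "r < ?N" for r
    unfolding system_matrix_row_sum[OF n that]
    by (intro fv_rhs_layer_constant_le[OF Q n]) (use mem[OF that] in \<open>simp_all add: unknowns_homogeneous\<close>)
qed

theorem mainTheorem2:
  fixes P :: diffusion_problem and n N :: nat and A :: "real mat"
  assumes "valid_problem P" and "n \<ge> 2"
  defines "N \<equiv> num_unknowns P n" and "A \<equiv> system_matrix P n"
  shows "(\<forall>\<tau>>0. invertible_mat (1\<^sub>m N - \<tau> \<cdot>\<^sub>m A) \<and> invertible_mat (1\<^sub>m N - (\<tau> / 2) \<cdot>\<^sub>m A))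
    \<and> unconditionally_stable (backward_euler_matrix A)
    \<and> unconditionally_stable (crank_nicolson_matrix A)"
proof -
  have A: "A \<in> carrier_mat N N" unfolding A_def N_def by (rule system_matrix_carrier)
  have N: "N > 0" unfolding N_def using assms(1,2) by (rule num_unknowns_pos)
  have Re_le: "Re z \<le> 0" if "eigenvalue (map_mat complex_of_real A) z" for z
    using Re_eigenvalue_system_matrix_nonpos[OF assms(1,2)] that by (simp add: A_def)
  have inv: "invertible_mat (1\<^sub>m N - c \<cdot>\<^sub>m A)" if "c > 0" for c
    using invertible_mat_one_minus_smult[OF A Re_le that] .
  have scheme: "stable (mat_inv (1\<^sub>m N - c \<cdot>\<^sub>m A) * (1\<^sub>m N + d \<cdot>\<^sub>m A))"
    if "c > 0" "0 \<le> d" "d \<le> c" for c d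
    using stable_one_step_scheme[OF A N Re_le that] .
  have "stable (backward_euler_matrix A \<tau>)" if \<tau>: "\<tau> > 0" for \<tau>
  proof -
    have "mat_inv (1\<^sub>m N - \<tau> \<cdot>\<^sub>m A) \<in> carrier_mat N N"
      using A inv[OF \<tau>] by (intro mat_inv(1) minus_carrier_mat smult_carrier_mat)
    moreover have "1\<^sub>m N + 0 \<cdot>\<^sub>m A = 1\<^sub>m N" using A by (intro eq_matI) auto
    ultimately show ?thesis
      using scheme[of \<tau> 0] \<tau> A by (simp add: backward_euler_matrix_def)
  qed
  moreover have "stable (crank_nicolson_matrix A \<tau>)" if "\<tau> > 0" for \<tau>
    using scheme[of "\<tau> / 2" "\<tau> / 2"] that A by (simp add: crank_nicolson_matrix_def)
  ultimately show ?thesis using inv by (simp add: unconditionally_stable_def)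
qed

end
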